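(* Let $f(x) = 1 - x + \sum_{k \text{ even},\, k \ge 4} \frac{x^k}{k!}$. Then the power series of the reciprocal $\frac{1}{f(x)}$ has all coefficients non-negative.
   Context: Power series are expanded about $0$ (formal power series in $x$). *)

theory Defs
  imports Complex_Main "HOL-Computational_Algebra.Formal_Power_Series"
begin

definition f :: "real fps" where
  "f = 1 - fps_X + Abs_fps (\<lambda>k. if even k \<and> k \<ge> 4 then 1 / fact k else 0)"

end

theory Submission
  imports Defs
begin

text \<open>
  The coefficients \<open>a\<^sub>n\<close> of \<open>1 / f\<close> decay at most geometrically, and this implies positivity.
  If \<open>f\<close> is non-positive at some \<open>y > 0\<close>, then \<open>a\<^sub>n \<le> y a\<^sub>n\<^sub>+\<^sub>1\<close> follows by induction: in the recurrence
  for \<open>a\<^sub>n\<^sub>+\<^sub>1\<close>, the earlier coefficients are bounded by \<open>a\<^sub>n\<close> times powers of \<open>y\<close>, and the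
  resulting factor is controlled by \<open>f(y) \<le> 0\<close>. The value \<open>y = 3/2\<close> works.
\<close>

text \<open>Assumption \<open>le\<close> encodes g(y) \<le> 0 through partial sums, so convergence
  never has to be discussed.\<close>

lemma fps_inverse_nth_nonneg:
  fixes g :: "real fps" and y :: real
  assumes g0: "fps_nth g 0 = 1" and g1: "fps_nth g 1 = -1"
    and nonneg: "\<And>k. k \<ge> 2 \<Longrightarrow> fps_nth g k \<ge> 0"
    and y: "y > 0"
    and le: "\<And>m. (\<Sum>k=2..m. fps_nth g k * y ^ k) \<le> y - 1"
  shows "fps_nth (inverse g) n \<ge> 0"
proof -
  define a where "a = fps_nth (inverse g)"
  have rec: "a (Suc n) = a n - (\<Sum>k=2..Suc n. fps_nth g k * a (Suc n - k))" for n
  proof -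
    have "g * inverse g = 1"
      using g0 by (simp add: inverse_mult_eq_1')
    then have "0 = fps_nth (g * inverse g) (Suc n)"
      by simp
    also have "\<dots> = (\<Sum>k=0..Suc n. fps_nth g k * a (Suc n - k))"
      by (simp only: fps_mult_nth a_def)
    also have "\<dots> = a (Suc n) - a n + (\<Sum>k=2..Suc n. fps_nth g k * a (Suc n - k))"
      using g0 g1 by (simp add: sum.atLeast_Suc_atMost numeral_2_eq_2)
    finally show ?thesis
      by simp
  qed
  \<comment> \<open>The recurrence reaches back to \<open>a 0\<close>, so the induction compares
    every earlier coefficient with the latest one.\<close>
  have "\<forall>k\<le>n. 0 \<le> a k \<and> a k \<le> y ^ (n - k) * a n" for n
  proof (induction n)
    case 0
    show ?case
      using g0 by (simp add: a_def)
  next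
    case (Suc n)
    \<comment> \<open>The extra factor \<open>y\<close> raises the exponent from k - 1 to k, which
      matches \<open>le\<close>.\<close>
    have "y * (\<Sum>k=2..Suc n. fps_nth g k * a (Suc n - k))
        = (\<Sum>k=2..Suc n. fps_nth g k * (y * a (Suc n - k)))"
      by (simp only: sum_distrib_left mult.left_commute)
    also have "\<dots> \<le> (\<Sum>k=2..Suc n. fps_nth g k * (y ^ k * a n))"
    proof (intro sum_mono mult_left_mono)
      fix k assume k: "k \<in> {2..Suc n}"
      then have "Suc n - k \<le> n"
        by auto
      then have "a (Suc n - k) \<le> y ^ (n - (Suc n - k)) * a n"
        using Suc.IH by blast
      with y have "y * a (Suc n - k) \<le> y ^ Suc (n - (Suc n - k)) * a n"
        by simp
      also have "Suc (n - (Suc n - k)) = k"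
        using k by auto
      finally show "y * a (Suc n - k) \<le> y ^ k * a n" .
    qed (use nonneg in auto)
    also have "\<dots> = (\<Sum>k=2..Suc n. fps_nth g k * y ^ k) * a n"
      by (simp only: sum_distrib_right mult.assoc)
    also have "\<dots> \<le> (y - 1) * a n"
      using Suc.IH by (intro mult_right_mono le) auto
    \<comment> \<open>By \<open>rec\<close> the sum equals \<open>a n - a (Suc n)\<close>; the terms
      \<open>y * a n\<close> cancel.\<close>
    finally have step: "a n \<le> y * a (Suc n)"
      by (simp add: rec[of n] algebra_simps)
    then have nonneg_Suc: "0 \<le> a (Suc n)"
      using y Suc.IH by (metis order_refl order_trans zero_le_mult_iff not_less)
    have "a k \<le> y ^ (Suc n - k) * a (Suc n)" if "k \<le> n" for k
    proof -
      have "a k \<le> y ^ (n - k) * a n"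
        using Suc.IH that by simp
      also have "\<dots> \<le> y ^ (n - k) * (y * a (Suc n))"
        using step y by (intro mult_left_mono) auto
      finally show ?thesis
        using that by (simp add: Suc_diff_le ac_simps)
    qed
    then show ?case
      using Suc.IH nonneg_Suc by (auto simp: le_Suc_eq)
  qed
  then show ?thesis
    by (auto simp: a_def)
qed

lemma fact_add_4_ge: "(fact (m + 4) :: real) \<ge> 24 * 4 ^ m"
proof (induction m)
  case 0
  show ?case
    by (simp add: fact_numeral)
next
  case (Suc m)
  have "24 * 4 ^ Suc m = 4 * (24 * 4 ^ m :: real)"
    by simp
  also have "\<dots> \<le> real (Suc (m + 4)) * fact (m + 4)"
    using Suc.IH by (intro mult_mono) auto
  also have "\<dots> = fact (Suc m + 4)"
    by (simp only: fact_Suc add_Suc)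
  finally show ?case .
qed

text \<open>The terms from k = 4 on are dominated by a geometric series of ratio (3/2)/4 = 3/8. The
  slack \<open>(3 / 8) ^ m / 2\<close> below y - 1 = 1/2 makes the induction work.\<close>

lemma sum_f_nth_le: "(\<Sum>k=2..m + 3. fps_nth f k * (3 / 2) ^ k) \<le> (1 - (3 / 8) ^ m) / 2"
proof (induction m)
  case 0
  show ?case
    by (simp add: f_def numeral_3_eq_3 numeral_2_eq_2)
next
  case (Suc m)
  have "fps_nth f (m + 4) \<le> 1 / fact (m + 4)"
    by (simp add: f_def)
  also have "\<dots> \<le> 1 / (24 * 4 ^ m)"
    using fact_add_4_ge[of m] by (intro divide_left_mono) auto
  finally have "fps_nth f (m + 4) * (3 / 2) ^ (m + 4) \<le> 1 / (24 * 4 ^ m) * (3 / 2) ^ (m + 4)"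
    by (intro mult_right_mono) auto
  also have "\<dots> = 27 / 128 * (3 / 8) ^ m"
    by (simp add: power_add power_divide flip: power_mult_distrib)
  \<comment> \<open>Here 5/16 = (1 - 3/8)/2, so this is exactly the growth of the claimed bound from
    \<open>m\<close> to \<open>Suc m\<close>.\<close>
  also have "\<dots> \<le> 5 / 16 * (3 / 8) ^ m"
    by simp
  finally have "fps_nth f (m + 4) * (3 / 2) ^ (m + 4) \<le> 5 / 16 * (3 / 8) ^ m" .
  moreover have "(\<Sum>k=2..Suc m + 3. fps_nth f k * (3 / 2) ^ k)
      = (\<Sum>k=2..m + 3. fps_nth f k * (3 / 2) ^ k) + fps_nth f (m + 4) * (3 / 2) ^ (m + 4)"
    by (simp add: eval_nat_numeral)
  ultimately show ?case
    using Suc.IH by simp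
qed

theorem theorem5p3:
  shows "\<forall>n. fps_nth (inverse f) n \<ge> 0"
proof
  fix n
  show "fps_nth (inverse f) n \<ge> 0"
  proof (rule fps_inverse_nth_nonneg)
    show "fps_nth f 0 = 1" "fps_nth f 1 = -1"
      by (simp_all add: f_def)
    show nonneg: "fps_nth f k \<ge> 0" if "k \<ge> 2" for k
      using that by (simp add: f_def)
    show "(\<Sum>k=2..m. fps_nth f k * (3 / 2) ^ k) \<le> 3 / 2 - 1" for m
    proof -
      \<comment> \<open>Padding by three nonnegative terms reaches the index form of
        \<open>sum_f_nth_le\<close>.\<close>
      have "(\<Sum>k=2..m. fps_nth f k * (3 / 2) ^ k) \<le> (\<Sum>k=2..m + 3. fps_nth f k * (3 / 2) ^ k)"
        using nonneg by (intro sum_mono2) auto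
      also have "\<dots> \<le> (1 - (3 / 8) ^ m) / 2"
        by (rule sum_f_nth_le)
      also have "\<dots> \<le> 3 / 2 - 1"
        by simp
      finally show ?thesis .
    qed
  qed simp
qed

end
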